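(* Let $m$ be a positive integer, $q=2^m$, and let $\gamma\in\mathbb{F}_{q^2}$ be such that either $\gamma\in\mathbb{F}_q$, or $m$ is odd and $\operatorname{Tr}_q^{q^2}(\gamma)=1$. Then the compositional inverse of the permutation polynomial $f_3(x)=x+\gamma\operatorname{Tr}_{q}^{q^2}(x+x^3+x^{q+2})$ over $\mathbb{F}_{q^2}$ is $$f_3^{-1}(x)=\begin{cases}x+\gamma\operatorname{Tr}_{q}^{q^2}(x)+\gamma(\operatorname{Tr}_{q}^{q^2}(x))^3, & \text{if } \gamma\in\mathbb{F}_q,\\ \operatorname{Tr}_{q}^{q^2}((1+\gamma)x)+\gamma(\operatorname{Tr}_{q}^{q^2}(x))^t, & \text{if } \operatorname{Tr}_{q}^{q^2}(\gamma)=1 \text{ and } m \text{ is odd},\end{cases}$$ where $t$ is a positive integer with $3t\equiv 1 \pmod{2^m-1}$.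
   Context: $\mathbb{F}_{q^2}$ is the finite field with $q^2$ elements and $\mathbb{F}_q$ its subfield with $q$ elements. $\operatorname{Tr}_q^{q^2}(z)=z+z^q$ for $z\in\mathbb{F}_{q^2}$. A polynomial $f\in\mathbb{F}_{q^2}[x]$ is a permutation polynomial over $\mathbb{F}_{q^2}$ if the map $a\mapsto f(a)$ is a bijection of $\mathbb{F}_{q^2}$. Its compositional inverse $f^{-1}$ is the polynomial $g$ (polynomials being identified with the maps $\mathbb{F}_{q^2}\to\mathbb{F}_{q^2}$ they induce) such that $f(g(x))=g(f(x))=x$ for every $x\in\mathbb{F}_{q^2}$. The integer $t$ is used only in the second case, where $m$ is odd and hence $\gcd(3,2^m-1)=1$. *)

theory Defs
  imports
    "HOL-Library.Cardinality"
    "HOL-Algebra.Algebraic_Closure_Type"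
    "HOL-Computational_Algebra.Polynomial"
    "HOL-Number_Theory.Cong"
begin

(* Stated over an arbitrary commutative semiring so that it applies to elements of the field
   with q^2 elements and, formally, to polynomials over that field. *)
definition Tr :: "nat \<Rightarrow> 'a::comm_semiring_1 \<Rightarrow> 'a" where
  "Tr q z = z + z ^ q"

definition permutation_polynomial :: "'a::comm_semiring_0 poly \<Rightarrow> bool" where
  "permutation_polynomial f \<longleftrightarrow> bij (poly f)"

(* The inverse is unique only as a map: polynomials inducing the same map are identified. *)
definition is_compositional_inverse ::
    "'a::comm_semiring_0 poly \<Rightarrow> 'a poly \<Rightarrow> bool" where
  "is_compositional_inverse f g \<longleftrightarrow>
     (\<forall>x. poly f (poly g x) = x \<and> poly g (poly f x) = x)"

abbreviation polyX :: "'a::comm_semiring_1 poly" where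
  "polyX \<equiv> [:0, 1:]"

definition f3 :: "nat \<Rightarrow> 'a::comm_semiring_1 \<Rightarrow> 'a poly" where
  "f3 q \<gamma> = polyX + Polynomial.smult \<gamma> (Tr q (polyX + polyX ^ 3 + polyX ^ (q + 2)))"

end

theory Submission
  imports Defs "HOL-Number_Theory.Residues"
begin

text \<open>
  Write \<open>T\<close> for the trace and \<open>\<Delta> = T x + (T x)\<^sup>3\<close>. Since \<open>2 = 0\<close> and the conjugate of
  \<open>x\<close> is \<open>x\<^sup>q\<close>, the cube \<open>(x + x\<^sup>q)\<^sup>3\<close> expands to the trace of \<open>x\<^sup>3 + x\<^sup>q \<cdot> x\<^sup>2\<close>. Hence
  \<open>f\<^sub>3\<close> is the map \<open>x \<mapsto> x + \<gamma>\<Delta>\<close>, which depends on \<open>x\<close> beyond the identity only through the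
  trace, and the trace of its value is \<open>T x + T(\<gamma>) \<Delta>\<close>, because \<open>\<Delta>\<close> is fixed by conjugation
  (lemmas \<open>poly_f3\<close> and \<open>Tr_poly_f3\<close>).

  If \<open>\<gamma>\<close> lies in the subfield, then \<open>T \<gamma> = 2\<gamma> = 0\<close>, so \<open>f\<^sub>3\<close> preserves the trace. Applying
  it twice therefore adds \<open>\<gamma>\<Delta>\<close> twice, which is nothing: \<open>f\<^sub>3\<close> is an involution, and the
  claimed inverse induces the same map as \<open>f\<^sub>3\<close>.

  If \<open>T \<gamma> = 1\<close>, then \<open>f\<^sub>3\<close> acts on traces as cubing, \<open>T x \<mapsto> (T x)\<^sup>3\<close>. When \<open>3 t\<close> is
  congruent to 1 modulo \<open>q - 1\<close>, raising the trace of the value to the power \<open>t\<close> recovers \<open>T x\<close>,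
  and \<open>x\<close> is then a combination of \<open>T x\<close> and of \<open>T ((1 + \<gamma>) f\<^sub>3(x))\<close>. This shows that the
  claimed map is a left inverse; it is a two-sided one because the field is finite. Such a \<open>t\<close>
  exists for odd \<open>m\<close>, so \<open>f\<^sub>3\<close> is a permutation in this case as well.
\<close>

section \<open>Powers, exponents and the characteristic of a finite field\<close>

text \<open>
  Multiplication by \<open>x\<close> permutes the set, so it does not change the product of all elements,
  which can be cancelled. The lemma speaks of a multiplicatively closed set rather than of a unit
  group so as to cover the subfield, given as a set, and the whole field, given as a type.
\<close>

lemma power_card_eq_1_of_mult_closed:
  fixes x :: "'a::idom"
  assumes "finite S" and "0 \<notin> S" and "x \<in> S"
    and closed: "\<And>a b. a \<in> S \<Longrightarrow> b \<in> S \<Longrightarrow> a * b \<in> S"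
  shows "x ^ card S = 1"
proof -
  have "x \<noteq> 0" using assms by auto
  then have inj: "inj_on ((*) x) S" by (auto intro: inj_onI)
  moreover have "(*) x ` S \<subseteq> S" using assms by auto
  ultimately have "(*) x ` S = S"
    using \<open>finite S\<close> by (intro endo_inj_surj)
  then have "\<Prod>S = (\<Prod>y\<in>S. x * y)"
    using prod.reindex[OF inj, of "\<lambda>y. y"] by (simp add: comp_def)
  also have "\<dots> = x ^ card S * \<Prod>S"
    by (simp add: prod.distrib)
  finally show ?thesis
    using assms by (auto simp: prod_zero_iff)
qed

lemma power_eq_self_of_mult_closed:
  fixes x :: "'a::idom"
  assumes "finite K" and "0 \<in> K" and "x \<in> K"
    and "\<And>a b. a \<in> K \<Longrightarrow> b \<in> K \<Longrightarrow> a * b \<in> K"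
  shows "x ^ card K = x"
proof (cases "x = 0")
  case True
  then show ?thesis using assms by (auto simp: power_0_left card_eq_0_iff)
next
  case False
  have "x ^ card (K - {0}) = 1"
    using assms False by (intro power_card_eq_1_of_mult_closed) auto
  moreover have "card K = Suc (card (K - {0}))"
    using assms(1,2) by (rule card.remove)
  ultimately show ?thesis by simp
qed

lemma subfield_power_card:
  fixes x :: "'a::{field, finite}"
  assumes "subfield K (ring_of_type_algebra :: 'a ring)" and "x \<in> K"
  shows "x ^ card K = x"
proof -
  note K = subfieldE(1)[OF assms(1)]
  interpret ring "ring_of_type_algebra :: 'a ring" by (rule ring_from_type_algebra)
  show ?thesis
    using subringE(2,6)[OF K] assms(2)
    by (intro power_eq_self_of_mult_closed) (auto simp: ring_of_type_algebra_def)
qed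

lemma power_eq_self_of_cong_1:
  fixes c :: "'a::idom"
  assumes "c ^ q = c" and "q > 0" and "n > 0" and "[n = 1] (mod (q - 1))"
  shows "c ^ n = c"
proof (cases "c = 0")
  case False
  have "c * c ^ (q - 1) = c * 1"
    using assms(1,2) by (simp flip: power_Suc)
  then have one: "c ^ (q - 1) = 1"
    using False by simp
  obtain k where "n = k * (q - 1) + 1"
    using assms(3,4) cong_le_nat[of 1 n "q - 1"] by (auto simp: cong_sym_eq)
  then have "c ^ n = c * (c ^ (q - 1)) ^ k"
    by (simp add: mult.commute flip: power_mult)
  then show ?thesis unfolding one by simp
qed (use assms in auto)

lemma CHAR_eq_2_of_card_power_2:
  assumes "CARD('a::{field, finite}) = 2 ^ n"
  shows "CHAR('a) = 2"
proof -
  have "CHAR('a) dvd 2 ^ n"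
    using CHAR_dvd_CARD[where 'a = 'a] assms by simp
  then obtain k where k: "CHAR('a) = 2 ^ k"
    by (auto simp: divides_primepow_nat)
  have "prime CHAR('a)"
    by (intro prime_CHAR_semidom finite_imp_CHAR_pos) auto
  then show ?thesis
    unfolding k by (simp add: prime_power_iff)
qed

lemma coprime_3_power_2_minus_1:
  assumes "odd m"
  shows "coprime 3 (2 ^ m - 1 :: nat)"
proof -
  obtain k where m: "m = 2 * k + 1"
    using assms by (rule oddE)
  have "[2 * (2 ^ 2) ^ k = 2 * 1 ^ k] (mod 3 :: nat)"
    by (intro cong_mult cong_pow) (simp_all add: cong_def)
  then have "2 ^ m mod 3 = (2::nat)"
    by (simp add: m power_mult cong_def)
  moreover have "2 ^ m \<ge> (1::nat)" by simp
  ultimately have "\<not> 3 dvd (2 ^ m - 1 :: nat)"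
    by presburger
  then show ?thesis
    by (intro prime_imp_coprime) auto
qed

section \<open>The trace of a quadratic extension in characteristic two\<close>

text \<open>
  The trace identities rest on these formal properties: the conjugation \<open>x \<mapsto> x\<^sup>q\<close> is an
  additive involution, and every element is its own negative.
\<close>

locale char2_conjugation =
  fixes q :: nat and field_type :: "'a::field itself"
  assumes add_self: "x + x = (0::'a)"
    and add_power: "(x + y :: 'a) ^ q = x ^ q + y ^ q"
    and power_power: "(x ^ q) ^ q = (x :: 'a)"
begin

lemma add_cancel: "x + (x + y) = (y::'a)"
  using add_self by (simp flip: add.assoc)

lemmas char2_simps = add_self add_cancel algebra_simps

lemma power_conj: "(x ^ n) ^ q = (x ^ q) ^ n" for x :: 'a
  by (metis mult.commute power_mult)

lemma Tr_add: "Tr q (x + y :: 'a) = Tr q x + Tr q y"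
  by (simp add: Tr_def add_power algebra_simps)

lemma Tr_power_q: "Tr q x ^ q = (Tr q x :: 'a)"
  by (simp add: Tr_def add_power power_power algebra_simps)

lemma Tr_mult_fixed:
  assumes "c ^ q = (c :: 'a)"
  shows "Tr q (x * c) = Tr q x * c"
  by (simp add: Tr_def power_mult_distrib assms algebra_simps)

text \<open>
  With \<open>y = x\<^sup>q\<close>, the traces of \<open>x\<^sup>3\<close> and \<open>x\<^sup>q\<^sup>+\<^sup>2 = y x\<^sup>2\<close> supply the four terms of
  \<open>(x + y)\<^sup>3\<close>, whose binomial coefficients 3 equal 1 here.
\<close>

lemma Tr_cubic:
  "Tr q (x + x ^ 3 + x ^ (q + 2)) = (Tr q x + Tr q x ^ 3 :: 'a)"
proof -
  define y where "y = x ^ q"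
  have y: "y ^ q = x" by (simp add: y_def power_power)
  have x3: "(x ^ 3) ^ q = y ^ 3"
    by (simp only: y_def power_conj)
  have "(y * x ^ 2) ^ q = x * y ^ 2"
    by (simp only: power_mult_distrib y power_conj flip: y_def)
  then show ?thesis
    by (simp add: Tr_def add_power x3 power_add flip: y_def)
       (simp add: power3_eq_cube power2_eq_square char2_simps)
qed

lemma poly_f3:
  "poly (f3 q \<gamma>) x = x + \<gamma> * (Tr q x + Tr q x ^ 3 :: 'a)"
proof -
  have "poly (f3 q \<gamma>) x = x + \<gamma> * Tr q (x + x ^ 3 + x ^ (q + 2))"
    by (simp add: f3_def Tr_def)
  then show ?thesis by (simp only: Tr_cubic)
qed

lemma Tr_cubic_fixed: "(Tr q x + Tr q x ^ 3) ^ q = (Tr q x + Tr q x ^ 3 :: 'a)"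
  by (simp add: add_power power_conj Tr_power_q)

lemma Tr_poly_f3:
  "Tr q (poly (f3 q \<gamma>) x) = Tr q x + Tr q \<gamma> * (Tr q x + Tr q x ^ 3 :: 'a)"
  by (simp add: poly_f3 Tr_add Tr_mult_fixed[OF Tr_cubic_fixed])

section \<open>The two cases of the inverse\<close>

lemma f3_involution:
  assumes "\<gamma> ^ q = (\<gamma> :: 'a)"
  shows "poly (f3 q \<gamma>) (poly (f3 q \<gamma>) x) = x"
proof -
  have "Tr q \<gamma> = 0"
    by (simp add: Tr_def assms add_self)
  then have "Tr q (poly (f3 q \<gamma>) x) = Tr q x"
    by (simp add: Tr_poly_f3)
  then have "poly (f3 q \<gamma>) (poly (f3 q \<gamma>) x)
      = poly (f3 q \<gamma>) x + \<gamma> * (Tr q x + Tr q x ^ 3)"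
    by (simp only: poly_f3[of \<gamma> "poly (f3 q \<gamma>) x"])
  then show ?thesis
    by (simp add: poly_f3 add.assoc add_self)
qed

text \<open>
  Since \<open>T \<gamma> = 1\<close>, the conjugate of \<open>\<gamma>\<close> is \<open>1 + \<gamma>\<close>, so \<open>(1 + \<gamma>) \<gamma>\<close> is the norm of \<open>\<gamma>\<close>. It is
  fixed by conjugation and so has trace 0; hence the term \<open>\<gamma>\<Delta>\<close> of \<open>f\<^sub>3(x)\<close> contributes nothing
  to \<open>T ((1 + \<gamma>) f\<^sub>3(x))\<close>. What remains is
  \<open>T ((1 + \<gamma>) x) = (1 + \<gamma>) x + \<gamma> x\<^sup>q = x + \<gamma> T x\<close>, and adding \<open>\<gamma> T x\<close> leaves \<open>x\<close>.
\<close>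

lemma f3_left_inverse:
  assumes trace: "Tr q \<gamma> = (1 :: 'a)" and "q > 0" and "t > 0" and "[3 * t = 1] (mod (q - 1))"
  shows "Tr q ((1 + \<gamma>) * poly (f3 q \<gamma>) x) + \<gamma> * Tr q (poly (f3 q \<gamma>) x) ^ t = x"
proof -
  define T where "T = Tr q x"
  define D where "D = T + T ^ 3"
  have conj: "\<gamma> ^ q = 1 + \<gamma>"
    using trace unfolding Tr_def by (metis add_cancel add.commute)
  have D: "D ^ q = D"
    unfolding D_def T_def by (rule Tr_cubic_fixed)
  have f: "poly (f3 q \<gamma>) x = x + \<gamma> * D"
    by (simp add: poly_f3 T_def D_def)
  have "Tr q (poly (f3 q \<gamma>) x) = T ^ 3"
    by (simp add: Tr_poly_f3 trace add_cancel flip: T_def)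
  moreover have "T ^ (3 * t) = T"
    unfolding T_def using assms by (intro power_eq_self_of_cong_1[OF Tr_power_q]) simp_all
  ultimately have root: "Tr q (poly (f3 q \<gamma>) x) ^ t = T"
    by (simp add: power_mult)
  have "Tr q ((1 + \<gamma>) * poly (f3 q \<gamma>) x) = Tr q ((1 + \<gamma>) * x) + Tr q ((1 + \<gamma>) * \<gamma>) * D"
    by (simp add: f distrib_left Tr_add Tr_mult_fixed[OF D] flip: mult.assoc)
  also have "Tr q ((1 + \<gamma>) * \<gamma>) = 0"
    by (simp add: Tr_def power_mult_distrib add_power conj char2_simps)
  also have "Tr q ((1 + \<gamma>) * x) = x + \<gamma> * T"
    by (simp add: Tr_def T_def power_mult_distrib add_power conj char2_simps)
  finally show ?thesis
    by (simp add: root add.assoc add_self)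
qed

end

lemma is_compositional_inverse_of_left_inverse:
  fixes f g :: "'a::{comm_semiring_0, finite} poly"
  assumes "\<And>x. poly g (poly f x) = x"
  shows "is_compositional_inverse f g"
proof -
  have "inj (poly f)"
    using assms by (rule inj_on_inverseI)
  then have "surj (poly f)"
    by (rule finite_UNIV_inj_surj[OF finite])
  then have "poly f (poly g x) = x" for x
    using assms by (metis surjD)
  then show ?thesis
    using assms by (simp add: is_compositional_inverse_def)
qed

lemma is_compositional_inverse_imp_permutation:
  "is_compositional_inverse f g \<Longrightarrow> permutation_polynomial f"
  unfolding is_compositional_inverse_def permutation_polynomial_def
  by (rule o_bij[of "poly g"]) (auto simp: fun_eq_iff)

theorem theorem3p3:
  fixes m q :: nat
    and Fq :: "'a::{field, finite} set"
    and \<gamma> :: 'a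
  assumes "m > 0"
    and "q = 2 ^ m"
    and "CARD('a) = q ^ 2"
    and "subfield Fq (ring_of_type_algebra :: 'a ring)"
    and "card Fq = q"
    and "\<gamma> \<in> Fq \<or> (odd m \<and> Tr q \<gamma> = 1)"
  shows "permutation_polynomial (f3 q \<gamma>) \<and>
    (\<gamma> \<in> Fq \<longrightarrow>
       is_compositional_inverse (f3 q \<gamma>)
         (polyX + Polynomial.smult \<gamma> (Tr q polyX) + Polynomial.smult \<gamma> (Tr q polyX ^ 3))) \<and>
    (Tr q \<gamma> = 1 \<and> odd m \<longrightarrow>
       (\<forall>t::nat. t > 0 \<and> [3 * t = 1] (mod (2 ^ m - 1)) \<longrightarrow>
          is_compositional_inverse (f3 q \<gamma>)
            (Tr q (Polynomial.smult (1 + \<gamma>) polyX) + Polynomial.smult \<gamma> (Tr q polyX ^ t))))"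
proof -
  note m = assms(1) and q = assms(2) and card = assms(3) and Fq = assms(4,5) and alternatives = assms(6)
  have CHAR: "CHAR('a) = 2"
    using card q by (intro CHAR_eq_2_of_card_power_2[of "m * 2"]) (simp add: power_mult)
  interpret char2_conjugation q "TYPE('a)"
  proof
    fix x y :: 'a
    have "of_nat 2 = (0 :: 'a)"
      using of_nat_CHAR[where 'a = 'a] CHAR by simp
    then show "x + x = 0"
      by (metis mult_2 mult_zero_left of_nat_numeral)
    show "(x + y) ^ q = x ^ q + y ^ q"
      using CHAR q by (intro freshmans_dream'[where n = m]) auto
    have "x ^ card (UNIV :: 'a set) = x"
      by (rule power_eq_self_of_mult_closed) auto
    then show "(x ^ q) ^ q = x"
      by (simp add: card power2_eq_square flip: power_mult)
  qed
  have subfield_case: "is_compositional_inverse (f3 q \<gamma>)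
      (polyX + Polynomial.smult \<gamma> (Tr q polyX) + Polynomial.smult \<gamma> (Tr q polyX ^ 3))"
    if "\<gamma> \<in> Fq"
  proof (rule is_compositional_inverse_of_left_inverse)
    fix x :: 'a
    have "\<gamma> ^ q = \<gamma>"
      using subfield_power_card[OF Fq(1) that] Fq(2) by simp
    moreover have "poly (polyX + Polynomial.smult \<gamma> (Tr q polyX)
        + Polynomial.smult \<gamma> (Tr q polyX ^ 3)) y = poly (f3 q \<gamma>) y" for y
      by (simp add: poly_f3 Tr_def distrib_left add.assoc)
    ultimately show "poly (polyX + Polynomial.smult \<gamma> (Tr q polyX)
        + Polynomial.smult \<gamma> (Tr q polyX ^ 3)) (poly (f3 q \<gamma>) x) = x"
      by (simp only: f3_involution)
  qed
  have trace_case: "is_compositional_inverse (f3 q \<gamma>)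
      (Tr q (Polynomial.smult (1 + \<gamma>) polyX) + Polynomial.smult \<gamma> (Tr q polyX ^ t))"
    if "Tr q \<gamma> = 1" "t > 0" "[3 * t = 1] (mod (2 ^ m - 1))" for t
  proof (rule is_compositional_inverse_of_left_inverse)
    fix x :: 'a
    have eval: "poly (Tr q (Polynomial.smult (1 + \<gamma>) polyX) + Polynomial.smult \<gamma> (Tr q polyX ^ t)) y
        = Tr q ((1 + \<gamma>) * y) + \<gamma> * Tr q y ^ t" for y
      by (simp add: Tr_def mult.commute)
    show "poly (Tr q (Polynomial.smult (1 + \<gamma>) polyX) + Polynomial.smult \<gamma> (Tr q polyX ^ t))
        (poly (f3 q \<gamma>) x) = x"
      unfolding eval using that q by (intro f3_left_inverse) auto
  qed
  have "permutation_polynomial (f3 q \<gamma>)"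
  proof (cases "\<gamma> \<in> Fq")
    case True
    then show ?thesis
      by (rule is_compositional_inverse_imp_permutation[OF subfield_case])
  next
    case False
    then have odd: "odd m" and trace: "Tr q \<gamma> = 1"
      using alternatives by auto
    obtain t :: nat where t: "[3 * t = 1] (mod (2 ^ m - 1))"
      using cong_solve_coprime_nat[OF coprime_3_power_2_minus_1[OF odd]] by auto
    \<comment> \<open>Adding the modulus makes the exponent positive; this matters for \<open>m = 1\<close>, where every
        congruence holds and \<open>t\<close> could be 0.\<close>
    have "[3 * (t + (2 ^ m - 1)) = 1] (mod (2 ^ m - 1))"
      using cong_add[OF t cong_mult_self_right[of 3 "2 ^ m - 1"]] by (simp only: distrib_left add_0_right)
    moreover have "(2::nat) ^ m > 1"
      using m by (intro one_less_power) auto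
    ultimately show ?thesis
      using is_compositional_inverse_imp_permutation[OF trace_case[OF trace]]
      by (metis add_gr_0 zero_less_diff)
  qed
  then show ?thesis
    using subfield_case trace_case by blast
qed

end
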